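(* Let $d\ge n$ be positive integers and let $p(t)=(p_1(t),\dots,p_n(t))$, $t\in[0,1]$, be a polynomial curve in $\mathbb{R}^n$ with $$p_j(t)=\sum_{k=1}^d a_{jk}t^k,\qquad a_{jk}\in\mathbb{R},\quad j=1,\dots,n,$$ and let $A=(a_{jk})$ be the $n\times d$ coefficient matrix. Suppose the kernel of the transpose $A^*$ is trivial over $\mathbb{R}$ (that is, $A^*x\neq 0$ for every nonzero $x\in\mathbb{R}^n$). Then there is a positive constant $C$ such that for all $\lambda>0$, $$\sup_{\nu\in\mathbb{Z}^n\setminus\{0\}}\|\nu\|^{1/d}\,|\hat\mu_\lambda(\nu)|\le\frac{C}{\lambda^{1/d}} .$$
   Context: $\mathbb{T}^n=\mathbb{R}^n/\mathbb{Z}^n$. For $\lambda>0$, $\mu_\lambda$ is the probability measure on $\mathbb{T}^n$ defined by $\int_{\mathbb{T}^n}\varphi\,d\mu_\lambda=\int_0^1\varphi(\lambda p(t))\,dt$ for continuous $\varphi$ on $\mathbb{T}^n$ (with $\lambda p(t)$ taken modulo $\mathbb{Z}^n$). Its Fourier coefficients are $\hat\mu_\lambda(\nu)=\int_{\mathbb{T}^n}e^{2\pi i\langle\nu,x\rangle}\,d\mu_\lambda(x)$, $\nu\in\mathbb{Z}^n$. $\|\cdot\|$ denotes the $\ell^1$-norm. *)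

theory Defs
  imports "HOL-Probability.Probability"
begin

quotient_type 'n torus = "real ^ ('n::finite)" / "\<lambda>x y. \<forall>i. x $ i - y $ i \<in> \<int>"
  morphisms torus_rep torus_proj
proof (rule equivpI)
  show "reflp (\<lambda>x y :: real ^ 'n. \<forall>i. x $ i - y $ i \<in> \<int>)"
    by (simp add: reflp_def)
  show "symp (\<lambda>x y :: real ^ 'n. \<forall>i. x $ i - y $ i \<in> \<int>)"
    unfolding symp_def by (metis Ints_minus minus_diff_eq)
  show "transp (\<lambda>x y :: real ^ 'n. \<forall>i. x $ i - y $ i \<in> \<int>)"
    unfolding transp_def by (metis Ints_add diff_add_cancel add_diff_eq)
qed

instantiation torus :: (finite) topological_space
begin

definition open_torus :: "'a torus set \<Rightarrow> bool" where
  "open_torus U \<longleftrightarrow> open (torus_proj -` U)"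

instance
proof
  show "open (UNIV :: 'a torus set)" by (simp add: open_torus_def)
  show "open (S \<inter> T)" if "open S" "open T" for S T :: "'a torus set"
    using that by (simp add: open_torus_def open_Int)
  show "open (\<Union>K)" if "\<forall>S\<in>K. open S" for K :: "'a torus set set"
    using that by (auto simp: open_torus_def vimage_Union)
qed

end

lemma continuous_on_torus_proj: "continuous_on UNIV torus_proj"
  by (simp add: continuous_on_open_vimage open_torus_def)

text \<open>The image on the torus, under reduction modulo the integer lattice, of Lebesgue measure on
  \<open>[0, 1]\<close> along the dilated curve \<open>\<lambda>p\<close>.\<close>

definition curve_measure :: "(real \<Rightarrow> real ^ 'n::finite) \<Rightarrow> real \<Rightarrow> 'n torus measure" where
  "curve_measure p l =
     distr (restrict_space lborel {0..1}) borel (\<lambda>t. torus_proj (l *\<^sub>R p t))"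

lift_definition torus_char :: "int ^ 'n::finite \<Rightarrow> 'n torus \<Rightarrow> complex" is
  "\<lambda>\<nu> x. exp (2 * of_real pi * \<i> * of_real (\<Sum>i\<in>UNIV. of_int (\<nu> $ i) * x $ i))"
proof -
  fix \<nu> :: "int ^ 'n" and x y :: "real ^ 'n"
  assume xy: "\<And>i. x $ i - y $ i \<in> \<int>"
  let ?s = "\<lambda>z. \<Sum>i\<in>UNIV. of_int (\<nu> $ i) * z $ i"
  have "?s x - ?s y = (\<Sum>i\<in>UNIV. of_int (\<nu> $ i) * (x $ i - y $ i))"
    by (simp add: sum_subtractf right_diff_distrib)
  also have "\<dots> \<in> \<int>" using xy by (intro Ints_sum Ints_mult) auto
  finally obtain m :: int where "?s x - ?s y = of_int m" by (auto elim: Ints_cases)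
  hence "?s x = ?s y + of_int m" by simp
  thus "exp (2 * of_real pi * \<i> * complex_of_real (?s x)) =
      exp (2 * of_real pi * \<i> * complex_of_real (?s y))"
    unfolding exp_eq by (intro exI[of _ m]) (simp add: algebra_simps del: of_real_sum)
qed

definition fourier_coeff :: "'n::finite torus measure \<Rightarrow> int ^ 'n \<Rightarrow> complex" where
  "fourier_coeff M \<nu> = (LINT x|M. torus_char \<nu> x)"

definition l1_norm :: "int ^ 'n::finite \<Rightarrow> real" where
  "l1_norm \<nu> = (\<Sum>i\<in>UNIV. real_of_int \<bar>\<nu> $ i\<bar>)"

definition poly_curve :: "nat \<Rightarrow> ('n::finite \<Rightarrow> nat \<Rightarrow> real) \<Rightarrow> real \<Rightarrow> real ^ 'n" where
  "poly_curve d a t = (\<chi> j. \<Sum>k=1..d. a j k * t ^ k)"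

text \<open>\<open>transpose_mult a x k\<close> is the \<open>k\<close>-th entry of \<open>A\<^sup>* x\<close>, where \<open>A\<close> is the matrix
  with entries \<open>a j k\<close> for \<open>1 \<le> k \<le> d\<close>; columns are numbered by \<open>nat\<close> because the column
  number is an exponent in \<open>poly_curve\<close>.\<close>

definition transpose_mult :: "('n::finite \<Rightarrow> nat \<Rightarrow> real) \<Rightarrow> real ^ 'n \<Rightarrow> nat \<Rightarrow> real" where
  "transpose_mult a x k = (\<Sum>j\<in>UNIV. a j k * x $ j)"

lemma continuous_poly_curve: "continuous_on UNIV (poly_curve d a)"
  unfolding poly_curve_def by (intro continuous_intros)

lemma measurable_curve:
  fixes p :: "real \<Rightarrow> real ^ 'n::finite"
  assumes "continuous_on {0..1} p"
  shows "(\<lambda>t. torus_proj (l *\<^sub>R p t)) \<in> restrict_space lborel {0..1} \<rightarrow>\<^sub>M borel"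
proof -
  have "continuous_on {0..1} (\<lambda>t. torus_proj (l *\<^sub>R p t))"
    by (rule continuous_on_compose2[OF continuous_on_torus_proj])
       (intro continuous_intros assms, auto)
  thus ?thesis
    using borel_measurable_continuous_on_restrict
    by (metis (no_types) measurable_cong_sets sets_lborel sets_restrict_space_cong)
qed

lemma prob_space_curve_measure:
  assumes "continuous_on {0..1} p"
  shows "prob_space (curve_measure p l)"
proof -
  have "prob_space (restrict_space lborel {0..1::real})"
    by (intro prob_spaceI) (simp add: emeasure_restrict_space space_restrict_space)
  thus ?thesis
    unfolding curve_measure_def by (rule prob_space.prob_space_distr) (rule measurable_curve[OF assms])
qed

lemma integral_curve_measure:
  fixes \<phi> :: "'n::finite torus \<Rightarrow> 'b::euclidean_space"
  assumes "continuous_on {0..1} p" "continuous_on UNIV \<phi>"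
  shows "(LINT x|curve_measure p l. \<phi> x) = integral {0..1} (\<lambda>t. \<phi> (torus_proj (l *\<^sub>R p t)))"
proof -
  have cont: "continuous_on {0..1} (\<lambda>t. \<phi> (torus_proj (l *\<^sub>R p t)))"
    by (rule continuous_on_compose2[OF assms(2)], rule continuous_on_compose2[OF continuous_on_torus_proj])
       (intro continuous_intros assms, auto)
  have "(LINT x|curve_measure p l. \<phi> x) =
      (LINT t|restrict_space lborel {0..1}. \<phi> (torus_proj (l *\<^sub>R p t)))"
    unfolding curve_measure_def
    by (rule integral_distr[OF measurable_curve[OF assms(1)] borel_measurable_continuous_onI[OF assms(2)]])
  also have "\<dots> = (LINT t:{0..1}|lborel. \<phi> (torus_proj (l *\<^sub>R p t)))"
    by (simp add: integral_restrict_space set_lebesgue_integral_def)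
  also have "\<dots> = integral {0..1} (\<lambda>t. \<phi> (torus_proj (l *\<^sub>R p t)))"
    by (rule set_borel_integral_eq_integral(2))
       (use borel_integrable_compact[OF compact_Icc cont] in
         \<open>simp add: set_integrable_def indicator_def if_distrib cong: if_cong\<close>)
  finally show ?thesis .
qed

lemma torus_measure_eqI:
  fixes M N :: "'n::finite torus measure"
  assumes M: "prob_space M" "sets M = sets borel" and N: "prob_space N" "sets N = sets borel"
    and eq: "\<And>\<phi> :: 'n torus \<Rightarrow> real. continuous_on UNIV \<phi> \<Longrightarrow> (LINT x|M. \<phi> x) = (LINT x|N. \<phi> x)"
  shows "M = N"
proof -
  interpret M: prob_space M by fact
  interpret N: prob_space N by fact
  note [measurable_cong] = M(2) N(2)
  have closed_eq: "emeasure M F = emeasure N F" if F: "closed F" for F :: "'n torus set"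
  proof (cases "F = {}")
    case False
    let ?C = "torus_proj -` F :: (real ^ 'n) set"
    have ne: "?C \<noteq> {}"
      using False by (metis ex_in_conv vimageI2 Quotient3_abs_rep[OF Quotient3_torus])
    have clC: "closed ?C"
      using F unfolding closed_def open_torus_def by (simp add: vimage_Compl)
    have inv: "infdist x ?C \<le> infdist y ?C" if xy: "torus_proj x = torus_proj y" for x y :: "real ^ 'n"
    proof -
      have "infdist x ?C \<le> dist y c" if c: "c \<in> ?C" for c
      proof -
        have "\<forall>i. x $ i - y $ i \<in> \<int>" using xy by (simp add: torus.abs_eq_iff)
        hence "torus_proj (c + (x - y)) = torus_proj c" by (simp add: torus.abs_eq_iff)
        hence "c + (x - y) \<in> ?C" using c by simp
        hence "infdist x ?C \<le> dist x (c + (x - y))" by (rule infdist_le)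
        also have "\<dots> = dist y c" by (simp add: dist_norm)
        finally show ?thesis .
      qed
      thus ?thesis using ne by (auto simp: infdist_notempty[of _ y] intro!: cINF_greatest)
    qed
    define g where "g z = infdist (torus_rep z) ?C" for z
    have g: "g (torus_proj x) = infdist x ?C" for x
      unfolding g_def using Quotient3_abs_rep[OF Quotient3_torus] by (intro antisym inv) auto
    have cont_g: "continuous_on UNIV g"
    proof -
      have "open (g -` B)" if "open B" for B
      proof -
        have "torus_proj -` (g -` B) = (\<lambda>x. infdist x ?C) -` B" using g by auto
        moreover have "open ((\<lambda>x. infdist x ?C) -` B)"
          by (intro open_vimage that continuous_intros)
        ultimately show ?thesis by (simp add: open_torus_def)
      qed
      thus ?thesis by (simp add: continuous_on_open_vimage)
    qed
    have g0: "g z = 0 \<longleftrightarrow> z \<in> F" for z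
    proof -
      have z: "torus_proj (torus_rep z) = z" by (rule Quotient3_abs_rep[OF Quotient3_torus])
      have "g z = 0 \<longleftrightarrow> torus_rep z \<in> ?C"
        unfolding g_def using in_closed_iff_infdist_zero[OF clC ne] by simp
      thus ?thesis using z by simp
    qed
    have g_nn: "g z \<ge> 0" for z by (simp add: g_def infdist_nonneg)
    define \<phi> where "\<phi> k z = max 0 (1 - real k * g z)" for k z
    have cont: "continuous_on UNIV (\<phi> k)" for k
      unfolding \<phi>_def by (intro continuous_intros cont_g)
    have lim: "(\<lambda>k. \<phi> k z) \<longlonglongrightarrow> indicator F z" for z
    proof (cases "z \<in> F")
      case True
      hence "g z = 0" by (simp add: g0)
      thus ?thesis using True by (simp add: \<phi>_def)
    next
      case nF: False
      hence pos: "g z > 0" using g0[of z] g_nn[of z] by linarith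
      obtain K where K: "real K * g z > 1" using reals_Archimedean3[OF pos] by blast
      have "\<phi> k z = 0" if "k \<ge> K" for k
      proof -
        have "real K * g z \<le> real k * g z" using that pos by simp
        thus ?thesis using K by (simp add: \<phi>_def)
      qed
      hence "eventually (\<lambda>k. \<phi> k z = 0) sequentially" by (auto simp: eventually_sequentially)
      thus ?thesis using nF by (simp add: tendsto_eventually)
    qed
    have bd: "norm (\<phi> k z) \<le> 1" for k z
      using g_nn[of z] by (simp add: \<phi>_def)
    have lims: "(\<lambda>k. LINT x|L. \<phi> k x) \<longlonglongrightarrow> measure L F"
      if L: "prob_space L" "sets L = sets borel" for L
    proof -
      interpret L: prob_space L by fact
      have [measurable]: "F \<in> sets L" using F L(2) by simp
      have [measurable]: "\<phi> k \<in> borel_measurable L" for k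
        using borel_measurable_continuous_onI[OF cont[of k]] L(2)
        by (simp cong: measurable_cong_sets)
      have "(\<lambda>k. LINT x|L. \<phi> k x) \<longlonglongrightarrow> (LINT x|L. indicator F x)"
        by (rule integral_dominated_convergence[where w = "\<lambda>_. 1"]) (use lim bd in auto)
      moreover have "F \<subseteq> space L" using L(2) sets_eq_imp_space_eq[OF L(2)] by simp
      ultimately show ?thesis by (simp add: Int_absorb1 Int_absorb2)
    qed
    have "(\<lambda>k. LINT x|M. \<phi> k x) = (\<lambda>k. LINT x|N. \<phi> k x)" using eq[OF cont] by auto
    hence "measure M F = measure N F"
      using lims[OF M] lims[OF N] LIMSEQ_unique by metis
    thus ?thesis by (simp add: M.emeasure_eq_measure N.emeasure_eq_measure)
  qed simp
  show ?thesis
  proof (rule measure_eqI_generator_eq[where E = "Collect closed" and \<Omega> = UNIV and A = "\<lambda>_. UNIV"])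
    show "sets M = sigma_sets UNIV (Collect closed)" "sets N = sigma_sets UNIV (Collect closed)"
      using M(2) N(2) borel_eq_closed
      by (metis sets_measure_of top_greatest Pow_UNIV)+
  qed (auto simp: Int_stable_def closed_eq)
qed

lemma curve_measure_characterization:
  fixes p :: "real \<Rightarrow> real ^ 'n::finite"
  assumes "continuous_on {0..1} p"
  shows "M = curve_measure p l \<longleftrightarrow>
    prob_space M \<and> sets M = sets borel \<and>
    (\<forall>\<phi> :: 'n torus \<Rightarrow> real. continuous_on UNIV \<phi> \<longrightarrow>
       (LINT x|M. \<phi> x) = integral {0..1} (\<lambda>t. \<phi> (torus_proj (l *\<^sub>R p t))))"
    (is "_ \<longleftrightarrow> ?R M")
proof
  have R: "?R (curve_measure p l)"
    using prob_space_curve_measure[OF assms] integral_curve_measure[OF assms]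
    by (auto simp: curve_measure_def)
  show "?R M" if "M = curve_measure p l" using R that by simp
  show "M = curve_measure p l" if "?R M"
    using that R by (intro torus_measure_eqI) auto
qed

end

theory Submission
  imports Defs
begin

text \<open>The Fourier coefficient is \<open>\<integral> exp (i q)\<close> over \<open>[0, 1]\<close> for a real polynomial phase \<open>q\<close> whose
  coefficients are, since \<open>A\<^sup>*\<close> is injective, at least of order \<open>\<lambda> \<parallel>\<nu>\<parallel>\<close>. Write this
  order as \<open>s\<close> to the power \<open>-d\<close> and cut \<open>[0, 1]\<close> at the boundedly many roots of \<open>q''\<close> and
  \<open>q' \<plusminus> \<epsilon>\<close>, where \<open>\<epsilon>\<close> is a small multiple of \<open>1/s\<close>. On a piece with \<open>\<bar>q'\<bar> \<ge> \<epsilon>\<close>, integration by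
  parts bounds the integral by \<open>4/\<epsilon>\<close>. A piece with \<open>\<bar>q'\<bar> \<le> \<epsilon>\<close> has length at most \<open>s\<close>, because
  a polynomial of degree \<open>d - 1\<close> that is small on a long interval has small coefficients.\<close>

section \<open>Coefficients and signs of real polynomials on an interval\<close>

lemma poly_eq_synthetic_div:
  fixes p :: "'a::comm_ring_1 poly"
  shows "p = [:poly p c:] + [:-c, 1:] * synthetic_div p c"
  using synthetic_div_correct'[of c p] by (simp add: add.commute)

text \<open>Dividing by t - u lowers the degree and, on the half of the interval away from u, costs
  only a factor of order 1 / (v - u), so each induction step pays one more power of the length. Read
  contrapositively, a polynomial with a large coefficient can be small only on a short
  interval.\<close>

lemma coeff_bound_of_small_on_interval:
  "\<exists>C\<ge>1. \<forall>(p::real poly) u v e k. degree p \<le> m \<longrightarrow> 0 \<le> u \<longrightarrow> u < v \<longrightarrow> v \<le> 1 \<longrightarrow>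
     (\<forall>t\<in>{u..v}. \<bar>poly p t\<bar> \<le> e) \<longrightarrow> \<bar>coeff p k\<bar> * (v - u) ^ m \<le> C * e"
proof (induction m)
  case 0
  have "\<bar>coeff p k\<bar> \<le> e"
    if deg: "degree p \<le> 0" and uv: "u < v" and e: "\<forall>t\<in>{u..v}. \<bar>poly p t\<bar> \<le> e"
    for p :: "real poly" and u v e :: real and k
  proof -
    obtain c where p: "p = [:c:]" using deg degree_eq_zeroE by blast
    have "\<bar>poly p u\<bar> \<le> e" using uv e by auto
    thus ?thesis by (cases k) (simp_all add: p)
  qed
  thus ?case by (intro exI[of _ 1]) auto
next
  case (Suc m)
  then obtain C where C1: "C \<ge> 1"
    and C: "\<And>(p::real poly) u v e k. \<lbrakk>degree p \<le> m; 0 \<le> u; u < v; v \<le> 1;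
      \<forall>t\<in>{u..v}. \<bar>poly p t\<bar> \<le> e\<rbrakk> \<Longrightarrow> \<bar>coeff p k\<bar> * (v - u) ^ m \<le> C * e"
    by blast
  have main: "\<bar>coeff p k\<bar> * (v - u) ^ Suc m \<le> (1 + 8 * 2 ^ m * C) * e"
    if deg: "degree p \<le> Suc m" and u: "0 \<le> u" and uv: "u < v" and v: "v \<le> 1"
      and e: "\<forall>t\<in>{u..v}. \<bar>poly p t\<bar> \<le> e"
    for p :: "real poly" and u v e :: real and k
  proof -
    define L where "L = v - u"
    define S where "S = synthetic_div p u"
    \<comment> \<open>The factor t - u vanishes at u but is at least \<open>L / 2\<close> to the
      right of the midpoint, so the induction hypothesis is applied to the quotient \<open>S\<close>
      on \<open>{w..v}\<close>.\<close>
    define w where "w = (u + v) / 2"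
    have L: "0 < L" "L \<le> 1" using u uv v by (auto simp: L_def)
    have pS: "p = [:poly p u:] + [:-u, 1:] * S"
      unfolding S_def by (rule poly_eq_synthetic_div)
    have pu: "\<bar>poly p u\<bar> \<le> e" using e uv by auto
    have Sb: "\<bar>poly S t\<bar> \<le> 4 * e / L" if t: "t \<in> {w..v}" for t
    proof -
      have tu: "t - u \<ge> L / 2" "t \<in> {u..v}" using t uv by (auto simp: w_def L_def field_simps)
      have "poly p t = poly p u + (t - u) * poly S t"
        by (subst pS) (simp add: algebra_simps)
      hence "(t - u) * \<bar>poly S t\<bar> = \<bar>poly p t - poly p u\<bar>"
        using tu L by (simp add: abs_mult)
      also have "\<dots> \<le> 2 * e" using pu e tu(2) by (smt (verit))
      finally have "(t - u) * \<bar>poly S t\<bar> \<le> 2 * e" .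
      moreover have "L / 2 * \<bar>poly S t\<bar> \<le> (t - u) * \<bar>poly S t\<bar>"
        using tu by (intro mult_right_mono) auto
      ultimately show ?thesis using L by (simp add: field_simps)
    qed
    have "\<bar>coeff S j\<bar> * (v - w) ^ m \<le> C * (4 * e / L)" for j
      by (rule C) (use deg u uv v Sb in \<open>auto simp: S_def degree_synthetic_div w_def\<close>)
    moreover have "v - w = L / 2" by (simp add: w_def L_def field_simps)
    ultimately have "\<bar>coeff S j\<bar> * (L / 2) ^ m \<le> C * (4 * e / L)" for j by simp
    hence cS: "\<bar>coeff S j\<bar> * L ^ Suc m \<le> 4 * 2 ^ m * C * e" for j
      using L by (simp add: field_simps)
    have e0: "0 \<le> e" using pu by linarith
    have LS: "L ^ Suc m \<le> 1" using L by (intro power_le_one) auto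
    \<comment> \<open>Multiplying out (t - u) S contributes a shifted coefficient of
      \<open>S\<close> and u times an unshifted one. Since u lies in [0, 1], the bound
      \<open>cS\<close> serves for both, and \<open>LS\<close> absorbs the power of \<open>L\<close>
      on the constant term.\<close>
    have "coeff p k = coeff [:poly p u:] k + (coeff ([:0, 1:] * S) k - u * coeff S k)"
      by (subst pS) simp
    moreover have "\<bar>coeff [:poly p u:] k\<bar> \<le> e" using pu e0 by (cases k) auto
    moreover have "\<bar>coeff ([:0, 1:] * S) k\<bar> * L ^ Suc m \<le> 4 * 2 ^ m * C * e"
      using cS C1 e0 by (cases k) auto
    moreover have "\<bar>u * coeff S k\<bar> \<le> \<bar>coeff S k\<bar>"
      using u uv v by (simp add: abs_mult mult_left_le_one_le)
    ultimately have A: "\<bar>coeff p k\<bar> \<le> e + \<bar>coeff ([:0, 1:] * S) k\<bar> + \<bar>coeff S k\<bar>"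
      and B: "\<bar>coeff ([:0, 1:] * S) k\<bar> * L ^ Suc m \<le> 4 * 2 ^ m * C * e"
      by linarith+
    have "\<bar>coeff p k\<bar> * L ^ Suc m \<le> (e + \<bar>coeff ([:0, 1:] * S) k\<bar> + \<bar>coeff S k\<bar>) * L ^ Suc m"
      using A L by (intro mult_right_mono) auto
    also have "\<dots> = e * L ^ Suc m + \<bar>coeff ([:0, 1:] * S) k\<bar> * L ^ Suc m + \<bar>coeff S k\<bar> * L ^ Suc m"
      by (simp only: distrib_right)
    also have "\<dots> \<le> e * 1 + 4 * 2 ^ m * C * e + 4 * 2 ^ m * C * e"
      by (intro add_mono B cS mult_left_mono LS e0)
    also have "\<dots> = (1 + 8 * 2 ^ m * C) * e" by (simp add: algebra_simps)
    finally show ?thesis by (simp add: L_def)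
  qed
  show ?case
    by (rule exI[of _ "1 + 8 * 2 ^ m * C"]) (use main C1 in auto)
qed

text \<open>A sign change would force a zero strictly inside, by the intermediate value theorem. The
  guard \<open>p \<noteq> 0\<close> admits the zero polynomial, which vanishes everywhere yet
  satisfies both weak inequalities.\<close>

lemma poly_constant_sign:
  fixes p :: "real poly"
  assumes "\<And>x. u < x \<Longrightarrow> x < v \<Longrightarrow> p \<noteq> 0 \<Longrightarrow> poly p x \<noteq> 0"
  shows "(\<forall>x\<in>{u..v}. 0 \<le> poly p x) \<or> (\<forall>x\<in>{u..v}. poly p x \<le> 0)"
proof (rule ccontr)
  assume "\<not> ?thesis"
  then obtain x y where x: "x \<in> {u..v}" "poly p x < 0" and y: "y \<in> {u..v}" "poly p y > 0"
    by (auto simp: not_le)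
  have "\<exists>z. u < z \<and> z < v \<and> poly p z = 0"
  proof (cases "x < y")
    case True
    with poly_IVT_pos[OF True x(2) y(2)] x(1) y(1) show ?thesis by force
  next
    case False
    with x(2) y(2) have "y < x" by (metis linorder_neqE not_less_iff_gr_or_eq)
    with poly_IVT_neg[OF this y(2) x(2)] x(1) y(1) show ?thesis by force
  qed
  moreover have "p \<noteq> 0" using x(2) by auto
  ultimately show False using assms by blast
qed

section \<open>Oscillatory integrals with polynomial phase\<close>

text \<open>Induction on the number of cut points strictly inside a subinterval: splitting at one of
  them removes it from both halves, and if l and r points remain there, (l + 1) + (r + 1) = (l + r +
  1) + 1.\<close>

lemma norm_integral_le_by_pieces:
  fixes f :: "real \<Rightarrow> complex"
  assumes cont: "continuous_on UNIV f" and Z: "finite Z" and "a \<le> b" and M: "0 \<le> M"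
    and piece: "\<And>u v. a \<le> u \<Longrightarrow> u \<le> v \<Longrightarrow> v \<le> b \<Longrightarrow> Z \<inter> {u<..<v} = {} \<Longrightarrow>
      norm (integral {u..v} f) \<le> M"
  shows "norm (integral {a..b} f) \<le> real (card Z + 1) * M"
proof -
  have "norm (integral {u..v} f) \<le> real (card (Z \<inter> {u<..<v}) + 1) * M"
    if "a \<le> u" "u \<le> v" "v \<le> b" for u v
    using that
  proof (induction "card (Z \<inter> {u<..<v})" arbitrary: u v rule: less_induct)
    case less
    show ?case
    proof (cases "Z \<inter> {u<..<v} = {}")
      case True
      thus ?thesis using piece[OF less.prems True] by simp
    next
      case False
      then obtain z where z: "z \<in> Z" "u < z" "z < v" by auto
      let ?l = "Z \<inter> {u<..<z}" and ?r = "Z \<inter> {z<..<v}"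
      have un: "Z \<inter> {u<..<v} = insert z (?l \<union> ?r)" using z by auto
      have "card (?l \<union> ?r) = card ?l + card ?r"
        by (intro card_Un_disjoint) (use Z in auto)
      hence c: "card (Z \<inter> {u<..<v}) = Suc (card ?l + card ?r)"
        unfolding un using Z by (subst card_insert_disjoint) auto
      have "integral {u..v} f = integral {u..z} f + integral {z..v} f"
        using z by (intro Henstock_Kurzweil_Integration.integral_combine[symmetric]
            integrable_continuous_interval continuous_on_subset[OF cont]) auto
      hence "norm (integral {u..v} f) \<le> norm (integral {u..z} f) + norm (integral {z..v} f)"
        by (simp add: norm_triangle_ineq)
      also have "\<dots> \<le> real (card ?l + 1) * M + real (card ?r + 1) * M"
        by (intro add_mono less.hyps) (use c z less.prems in auto)
      also have "\<dots> = real (card (Z \<inter> {u<..<v}) + 1) * M"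
        unfolding c by (simp add: algebra_simps)
      finally show ?thesis .
    qed
  qed
  from this[of a b] have "norm (integral {a..b} f) \<le> real (card (Z \<inter> {a<..<b}) + 1) * M"
    using \<open>a \<le> b\<close> by simp
  also have "\<dots> \<le> real (card Z + 1) * M"
    using card_mono[OF Z, of "Z \<inter> {a<..<b}"] M by (intro mult_right_mono) auto
  finally show ?thesis .
qed

lemma continuous_on_cis_poly: "continuous_on S (\<lambda>t. cis (poly q t))"
  unfolding cis_conv_exp by (intro continuous_intros)

lemma norm_integral_cis_poly_le_length:
  assumes "u \<le> v"
  shows "norm (integral {u..v} (\<lambda>t. cis (poly q t))) \<le> v - u"
  using integral_bound[OF assms continuous_on_cis_poly, of q 1] by simp

text \<open>The second-derivative sign condition makes \<open>1/q'\<close> monotone, so the remainder after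
  integrating by parts is controlled by the boundary values of \<open>1/q'\<close>.\<close>

lemma van_der_Corput_first_derivative:
  fixes q :: "real poly"
  assumes uv: "u \<le> v" and e: "0 < e" and lower: "\<And>t. t \<in> {u..v} \<Longrightarrow> e \<le> \<bar>poly (pderiv q) t\<bar>"
    and sign: "(\<forall>t\<in>{u..v}. 0 \<le> poly (pderiv (pderiv q)) t) \<or>
      (\<forall>t\<in>{u..v}. poly (pderiv (pderiv q)) t \<le> 0)"
  shows "norm (integral {u..v} (\<lambda>t. cis (poly q t))) \<le> 4 / e"
proof -
  define r where "r = poly (pderiv q)"
  define r' where "r' = poly (pderiv (pderiv q))"
  have r0: "r t \<noteq> 0" if "t \<in> {u..v}" for t using lower[OF that] e by (auto simp: r_def)
  have inv: "\<bar>1 / r t\<bar> \<le> 1 / e" if "t \<in> {u..v}" for t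
    using lower[OF that] e by (auto simp: r_def abs_divide intro!: divide_left_mono mult_pos_pos)
  \<comment> \<open>\<open>F\<close> is an antiderivative of \<open>cis (poly q t)\<close> up to the
    error \<open>g\<close>, and each of its boundary values has norm at most
    \<open>1 / e\<close>.\<close>
  define F where "F t = - \<i> * cis (poly q t) / of_real (r t)" for t
  define g where "g t = \<i> * cis (poly q t) * of_real (r' t / (r t)\<^sup>2)" for t
  have dq: "(poly q has_real_derivative r t) (at t within {u..v})" for t
    unfolding r_def using poly_DERIV DERIV_subset by blast
  have dr: "(r has_real_derivative r' t) (at t within {u..v})" for t
    unfolding r_def r'_def using poly_DERIV DERIV_subset by blast
  have dF: "(F has_vector_derivative (cis (poly q t) + g t)) (at t within {u..v})"
    if t: "t \<in> {u..v}" for t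
  proof -
    have "((\<lambda>t. cis (poly q t)) has_vector_derivative (of_real (r t) * (\<i> * cis (poly q t))))
        (at t within {u..v})"
    proof -
      have "((\<lambda>x. cis x) has_vector_derivative \<i> * cis (poly q t)) (at (poly q t) within S)" for S
        unfolding cis_conv_exp
        by (rule has_vector_derivative_real_field) (auto intro!: derivative_eq_intros)
      from vector_diff_chain_within[OF dq[of t, unfolded has_real_derivative_iff_has_vector_derivative] this]
      show ?thesis by (simp add: o_def scaleR_conv_of_real)
    qed
    moreover have "((\<lambda>t. complex_of_real (1 / r t)) has_vector_derivative
        of_real (- r' t / (r t)\<^sup>2)) (at t within {u..v})"
      by (intro has_vector_derivative_of_real)
        (rule derivative_eq_intros dr refl r0 t | simp add: power2_eq_square)+
    ultimately have "((\<lambda>t. - \<i> * (cis (poly q t) * complex_of_real (1 / r t))) has_vector_derivative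
        - \<i> * (cis (poly q t) * of_real (- r' t / (r t)\<^sup>2) +
          of_real (r t) * (\<i> * cis (poly q t)) * complex_of_real (1 / r t))) (at t within {u..v})"
      by (intro has_vector_derivative_mult_right has_vector_derivative_mult)
    moreover have "- \<i> * (cis (poly q t) * of_real (- r' t / (r t)\<^sup>2) +
          of_real (r t) * (\<i> * cis (poly q t)) * complex_of_real (1 / r t)) = cis (poly q t) + g t"
      using r0[OF t] by (simp add: g_def field_simps)
    ultimately show ?thesis by (simp add: F_def[abs_def])
  qed
  have cont_r: "continuous_on {u..v} r" "continuous_on {u..v} r'"
    unfolding r_def r'_def by (intro continuous_intros)+
  have cg: "continuous_on {u..v} g"
    unfolding g_def cis_conv_exp by (intro continuous_intros cont_r) (use r0 in auto)
  have int: "((\<lambda>t. cis (poly q t) + g t) has_integral (F v - F u)) {u..v}"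
    by (rule fundamental_theorem_of_calculus[OF uv dF])
  have intg: "g integrable_on {u..v}" by (rule integrable_continuous_interval[OF cg])
  have eq: "integral {u..v} (\<lambda>t. cis (poly q t)) = F v - F u - integral {u..v} g"
    using has_integral_diff[OF int integrable_integral[OF intg]] by (simp add: integral_unique)
  have normF: "norm (F t) \<le> 1 / e" if "t \<in> {u..v}" for t
    using inv[OF that] by (simp add: F_def norm_mult norm_divide)
  \<comment> \<open>\<open>\<sigma>\<close> is the constant sign of \<open>r'\<close>. It turns the
    norm of \<open>g\<close> into the derivative of \<open>- \<sigma> / r\<close>, so the error
    integral costs two boundary values, whatever the length of the interval.\<close>
  obtain \<sigma> :: real where \<sigma>: "\<bar>\<sigma>\<bar> = 1" "\<And>t. t \<in> {u..v} \<Longrightarrow> \<bar>r' t\<bar> = \<sigma> * r' t"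
  proof (cases "\<forall>t\<in>{u..v}. 0 \<le> r' t")
    case True
    thus ?thesis by (intro that[of 1]) auto
  next
    case False
    thus ?thesis using sign by (intro that[of "-1"]) (auto simp: r'_def)
  qed
  have "((\<lambda>t. - \<sigma> / r t) has_vector_derivative (\<sigma> * r' t / (r t)\<^sup>2)) (at t within {u..v})"
    if t: "t \<in> {u..v}" for t
    unfolding has_real_derivative_iff_has_vector_derivative[symmetric]
    by (rule derivative_eq_intros dr refl r0 t)+ (simp add: power2_eq_square)
  hence int_r: "((\<lambda>t. \<sigma> * r' t / (r t)\<^sup>2) has_integral (- \<sigma> / r v - - \<sigma> / r u)) {u..v}"
    by (rule fundamental_theorem_of_calculus[OF uv])
  have "norm (integral {u..v} g) \<le> integral {u..v} (\<lambda>t. \<sigma> * r' t / (r t)\<^sup>2)"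
  proof (rule integral_norm_bound_integral[OF intg has_integral_integrable[OF int_r]])
    fix t assume "t \<in> {u..v}"
    from \<sigma>(2)[OF this] show "norm (g t) \<le> \<sigma> * r' t / (r t)\<^sup>2"
      by (simp add: g_def norm_mult norm_divide norm_power)
  qed
  also have "\<dots> = \<sigma> * (1 / r u) - \<sigma> * (1 / r v)" using int_r by (simp add: integral_unique)
  also have "\<dots> \<le> \<bar>\<sigma> * (1 / r u)\<bar> + \<bar>\<sigma> * (1 / r v)\<bar>" by linarith
  also have "\<dots> \<le> 1 / e + 1 / e"
    using inv[of u] inv[of v] uv \<sigma>(1) unfolding abs_mult by (intro add_mono) auto
  finally have ng: "norm (integral {u..v} g) \<le> 1 / e + 1 / e" .
  have "norm (integral {u..v} (\<lambda>t. cis (poly q t))) \<le> norm (F v) + norm (F u) + norm (integral {u..v} g)"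
    unfolding eq by (meson norm_triangle_ineq4 order_trans add_right_mono)
  also have "\<dots> \<le> 1 / e + 1 / e + (1 / e + 1 / e)"
    using normF[of u] normF[of v] uv ng by (intro add_mono) auto
  finally show ?thesis by simp
qed

text \<open>The parameter \<open>s\<close> is a length scale: slow pieces are no longer than
  \<open>s\<close>, and fast pieces contribute a multiple of \<open>s\<close>. Writing the
  coefficient bound as \<open>1 / s ^ d\<close> avoids d-th roots here; \<open>K\<close> depends on
  \<open>d\<close> only.\<close>

lemma oscillatory_integral_cis_poly:
  assumes "1 \<le> d"
  shows "\<exists>K>0. \<forall>(q::real poly) s k. degree q \<le> d \<longrightarrow> 0 < s \<longrightarrow> 1 \<le> k \<longrightarrow> 1 / s ^ d \<le> \<bar>coeff q k\<bar> \<longrightarrow>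
    norm (integral {0..1} (\<lambda>t. cis (poly q t))) \<le> K * s"
proof -
  obtain C where C1: "C \<ge> 1"
    and C: "\<And>(p::real poly) u v e k. \<lbrakk>degree p \<le> d - 1; 0 \<le> u; u < v; v \<le> 1;
      \<forall>t\<in>{u..v}. \<bar>poly p t\<bar> \<le> e\<rbrakk> \<Longrightarrow> \<bar>coeff p k\<bar> * (v - u) ^ (d - 1) \<le> C * e"
    using coeff_bound_of_small_on_interval[of "d - 1"] by blast
  have main: "norm (integral {0..1} (\<lambda>t. cis (poly q t))) \<le> (real (3 * d + 1) * (8 * C)) * s"
    if deg: "degree q \<le> d" and s: "0 < s" and k: "1 \<le> k" and coeff: "1 / s ^ d \<le> \<bar>coeff q k\<bar>"
    for q :: "real poly" and s k
  proof -
    \<comment> \<open>This threshold makes \<open>4 / e\<close> equal to \<open>8 * C * s\<close> on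
      fast pieces, while \<open>C * e\<close> is \<open>1 / (2 * s)\<close>, strictly below the
      \<open>1 / s\<close> that a slow piece longer than \<open>s\<close> would require.\<close>
    define e where "e = 1 / (2 * C * s)"
    have e: "0 < e" using C1 s by (simp add: e_def)
    define P where "P = {pderiv (pderiv q), pderiv q - [:e:], pderiv q + [:e:]}"
    \<comment> \<open>A member of \<open>P\<close> can be the zero polynomial, for example the
      second derivative of a linear phase. It is left out to keep \<open>Z\<close> finite, and
      \<open>poly_constant_sign\<close> still covers it.\<close>
    define Z where "Z = (\<Union>p\<in>P - {0}. {x. poly p x = 0})"
    have degP: "degree p \<le> d" if "p \<in> P" for p
    proof -
      have "degree (pderiv q) \<le> d" "degree (pderiv (pderiv q)) \<le> d"
        using deg by (auto simp: degree_pderiv)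
      thus ?thesis using that by (auto simp: P_def intro: degree_add_le degree_diff_le)
    qed
    have finP: "finite (P - {0})" by (simp add: P_def)
    have "card P \<le> 3" unfolding P_def by (simp add: card_insert_if)
    hence cardP: "card (P - {0}) \<le> 3" using card_mono[of P "P - {0}"] by (auto simp: P_def)
    have finZ: "finite Z" unfolding Z_def using finP by (auto intro: poly_roots_finite)
    have "card Z \<le> (\<Sum>p\<in>P - {0}. card {x. poly p x = 0})"
      unfolding Z_def by (rule card_UN_le[OF finP])
    also have "\<dots> \<le> card (P - {0}) * d"
      by (rule sum_bounded_above[where 'a = nat, simplified])
        (use card_poly_roots_bound degP in \<open>force intro: order_trans\<close>)
    also have "\<dots> \<le> 3 * d" using cardP by simp
    finally have cardZ: "card Z \<le> 3 * d" .
    have "norm (integral {0..1} (\<lambda>t. cis (poly q t))) \<le> real (card Z + 1) * (8 * C * s)"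
    proof (rule norm_integral_le_by_pieces[OF continuous_on_cis_poly finZ])
      show "0 \<le> 8 * C * s" using C1 s by simp
      fix u v :: real
      assume u: "0 \<le> u" and uv: "u \<le> v" and v: "v \<le> 1" and Zuv: "Z \<inter> {u<..<v} = {}"
      have sign: "(\<forall>x\<in>{u..v}. 0 \<le> poly p x) \<or> (\<forall>x\<in>{u..v}. poly p x \<le> 0)" if "p \<in> P" for p
        by (rule poly_constant_sign) (use Zuv that in \<open>auto simp: Z_def\<close>)
      show "norm (integral {u..v} (\<lambda>t. cis (poly q t))) \<le> 8 * C * s"
      proof (cases "\<forall>t\<in>{u..v}. e \<le> \<bar>poly (pderiv q) t\<bar>")
        case True
        have "norm (integral {u..v} (\<lambda>t. cis (poly q t))) \<le> 4 / e"
          by (rule van_der_Corput_first_derivative[OF uv e])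
            (use True sign[of "pderiv (pderiv q)"] in \<open>auto simp: P_def\<close>)
        thus ?thesis by (simp add: e_def)
      next
        case False
        \<comment> \<open>One point with \<bar>q'\<bar> < e decides the signs of q' - e and q' + e
          on the whole piece, so every piece is either fast throughout or slow throughout.\<close>
        then obtain t where t: "t \<in> {u..v}" "\<bar>poly (pderiv q) t\<bar> < e" by force
        have "\<forall>x\<in>{u..v}. poly (pderiv q - [:e:]) x \<le> 0"
          using sign[of "pderiv q - [:e:]"] t by (force simp: P_def)
        moreover have "\<forall>x\<in>{u..v}. poly (pderiv q + [:e:]) x \<ge> 0"
          using sign[of "pderiv q + [:e:]"] t by (force simp: P_def)
        ultimately have small: "\<forall>x\<in>{u..v}. \<bar>poly (pderiv q) x\<bar> \<le> e"
          by (force simp: abs_le_iff)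
        have "v - u \<le> s"
        proof (rule ccontr)
          assume "\<not> v - u \<le> s"
          hence vu: "s < v - u" by simp
          \<comment> \<open>Coefficient k - 1 of q' is k times coefficient k of q, hence no smaller
            in absolute value as k is at least 1. The exponent \<open>d - 1\<close> is the degree
            bound for q', and the left side equals \<open>1 / s\<close>.\<close>
          have "1 / s ^ d * s ^ (d - 1) \<le> \<bar>coeff q k\<bar> * (v - u) ^ (d - 1)"
            using coeff s vu by (intro mult_mono power_mono) auto
          also have "\<dots> \<le> \<bar>coeff (pderiv q) (k - 1)\<bar> * (v - u) ^ (d - 1)"
            using k vu s by (intro mult_right_mono)
              (auto simp: coeff_pderiv abs_mult mult_le_cancel_right1)
          also have "\<dots> \<le> C * e"
            by (rule C) (use deg u v vu s small in \<open>auto simp: degree_pderiv\<close>)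
          also have "\<dots> = 1 / (2 * s)" using C1 by (simp add: e_def)
          finally have "1 / s ^ d * s ^ (d - 1) \<le> 1 / (2 * s)" .
          moreover have "s ^ d = s * s ^ (d - 1)" using assms by (simp add: power_eq_if)
          ultimately show False using s by (simp add: field_simps)
        qed
        also have "s \<le> 8 * C * s" using C1 s by simp
        finally show ?thesis using norm_integral_cis_poly_le_length[OF uv, of q] by linarith
      qed
    qed simp
    also have "\<dots> \<le> real (3 * d + 1) * (8 * C * s)"
      using cardZ C1 s by (intro mult_right_mono) auto
    finally show ?thesis by (simp add: mult.assoc)
  qed
  show ?thesis
    by (rule exI[of _ "real (3 * d + 1) * (8 * C)"]) (use main C1 in auto)
qed

section \<open>Quantitative injectivity of the transposed coefficient matrix\<close>

lemma transpose_mult_scaleR: "transpose_mult a (c *\<^sub>R x) k = c * transpose_mult a x k"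
  by (simp add: transpose_mult_def sum_distrib_left algebra_simps)

text \<open>By compactness, the sum of the absolute entries of the image has a positive minimum on
  the Euclidean unit sphere, and homogeneity extends this to all vectors. The index k of a large
  entry may vary with x.\<close>

lemma transpose_mult_bounded_below:
  fixes a :: "'n::finite \<Rightarrow> nat \<Rightarrow> real"
  assumes inj: "\<And>x :: real ^ 'n. x \<noteq> 0 \<Longrightarrow> \<exists>k\<in>{1..d}. transpose_mult a x k \<noteq> 0"
  shows "\<exists>c>0. \<forall>x. \<exists>k\<in>{1..d}. c * (\<Sum>i\<in>UNIV. \<bar>x $ i\<bar>) \<le> \<bar>transpose_mult a x k\<bar>"
proof -
  define h where "h x = (\<Sum>k=1..d. \<bar>transpose_mult a x k\<bar>)" for x :: "real ^ 'n"
  have "continuous_on (sphere 0 1) h"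
    unfolding h_def transpose_mult_def by (intro continuous_intros)
  moreover have "sphere (0 :: real ^ 'n) 1 \<noteq> {}" by simp
  ultimately obtain x0 where x0: "x0 \<in> sphere 0 1" "\<And>x. x \<in> sphere 0 1 \<Longrightarrow> h x0 \<le> h x"
    using continuous_attains_inf[of "sphere (0 :: real ^ 'n) 1" h] by auto
  \<comment> \<open>Here \<open>1\<close> is the all-ones vector; for \<open>d = 0\<close> it would
    have no index k to choose.\<close>
  have d: "0 < d" using inj[of 1] by (cases d) auto
  have "x0 \<noteq> 0" using x0(1) by auto
  from inj[OF this] have h0: "0 < h x0"
    unfolding h_def by (force intro: sum_pos2)
  \<comment> \<open>The factor \<open>d\<close> passes from the sum of the entries to the largest
    one, and \<open>CARD('n)\<close> from the Euclidean norm to the l1 norm.\<close>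
  define c where "c = h x0 / (d * CARD('n))"
  have c: "0 < c" using h0 d by (simp add: c_def)
  have "\<exists>k\<in>{1..d}. c * (\<Sum>i\<in>UNIV. \<bar>x $ i\<bar>) \<le> \<bar>transpose_mult a x k\<bar>" for x :: "real ^ 'n"
  proof (rule ccontr)
    assume "\<not> ?thesis"
    hence "\<And>k. k \<in> {1..d} \<Longrightarrow> \<bar>transpose_mult a x k\<bar> < c * (\<Sum>i\<in>UNIV. \<bar>x $ i\<bar>)" by force
    hence "h x < (\<Sum>k=1..d. c * (\<Sum>i\<in>UNIV. \<bar>x $ i\<bar>))"
      unfolding h_def using d by (intro sum_strict_mono) auto
    also have "\<dots> = h x0 / CARD('n) * (\<Sum>i\<in>UNIV. \<bar>x $ i\<bar>)" using d by (simp add: c_def)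
    also have "(\<Sum>i\<in>UNIV. \<bar>x $ i\<bar>) \<le> CARD('n) * norm x"
      using sum_bounded_above[of UNIV "\<lambda>i. \<bar>x $ i\<bar>" "norm x"] component_le_norm_cart[of x] by simp
    finally have *: "h x < h x0 * norm x"
      using h0 by (simp add: mult_left_mono field_simps)
    hence "x \<noteq> 0" by (auto simp: h_def transpose_mult_def)
    hence "x /\<^sub>R norm x \<in> sphere 0 1" "h (x /\<^sub>R norm x) = h x / norm x"
      by (auto simp: h_def transpose_mult_scaleR abs_mult sum_distrib_left[symmetric] divide_inverse mult.commute)
    with x0(2)[of "x /\<^sub>R norm x"] have "h x0 \<le> h x / norm x" by simp
    with * \<open>x \<noteq> 0\<close> show False by (simp add: field_simps)
  qed
  thus ?thesis using c by blast
qed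

section \<open>Fourier coefficients of the curve measure and their decay\<close>

lemma continuous_on_torus_char: "continuous_on UNIV (torus_char \<nu>)"
proof -
  have "open (torus_char \<nu> -` B)" if "open B" for B
  proof -
    have "open ((\<lambda>x. exp (2 * of_real pi * \<i> * of_real (\<Sum>i\<in>UNIV. of_int (\<nu> $ i) * x $ i))) -` B)"
      by (intro open_vimage that continuous_intros)
    thus ?thesis
      by (simp add: open_torus_def vimage_def torus_char.abs_eq)
  qed
  thus ?thesis by (simp add: continuous_on_open_vimage)
qed

text \<open>This is 2 pi times the pairing of \<nu> with the dilated curve, sorted by powers of t.
  The sorting exposes the entries of the transposed matrix applied to \<nu> as coefficients, all at
  exponents at least 1 as the oscillatory estimate demands.\<close>

definition curve_phase :: "nat \<Rightarrow> ('n::finite \<Rightarrow> nat \<Rightarrow> real) \<Rightarrow> real \<Rightarrow> int ^ 'n \<Rightarrow> real poly" where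
  "curve_phase d a l \<nu> =
     (\<Sum>k=1..d. monom (2 * pi * l * transpose_mult a (\<chi> i. of_int (\<nu> $ i)) k) k)"

lemma degree_curve_phase: "degree (curve_phase d a l \<nu>) \<le> d"
  unfolding curve_phase_def
  by (intro degree_sum_le) (auto intro: order_trans[OF degree_monom_le])

lemma coeff_curve_phase:
  "k \<in> {1..d} \<Longrightarrow> coeff (curve_phase d a l \<nu>) k = 2 * pi * l * transpose_mult a (\<chi> i. of_int (\<nu> $ i)) k"
  by (simp add: curve_phase_def coeff_sum)

lemma torus_char_poly_curve:
  "torus_char \<nu> (torus_proj (l *\<^sub>R poly_curve d a t)) = cis (poly (curve_phase d a l \<nu>) t)"
proof -
  have "2 * pi * (\<Sum>i\<in>UNIV. of_int (\<nu> $ i) * (l *\<^sub>R poly_curve d a t) $ i) =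
      (\<Sum>i\<in>UNIV. \<Sum>k=1..d. 2 * pi * l * (a i k * of_int (\<nu> $ i)) * t ^ k)"
    by (simp add: poly_curve_def sum_distrib_left algebra_simps)
  also have "\<dots> = poly (curve_phase d a l \<nu>) t"
    by (subst sum.swap)
      (simp add: curve_phase_def poly_sum poly_monom transpose_mult_def sum_distrib_left sum_distrib_right)
  finally have "2 * pi * (\<Sum>i\<in>UNIV. of_int (\<nu> $ i) * (l *\<^sub>R poly_curve d a t) $ i) =
    poly (curve_phase d a l \<nu>) t" .
  thus ?thesis
    unfolding torus_char.abs_eq cis_conv_exp
    by (metis (no_types, lifting) mult.assoc mult.commute of_real_mult of_real_numeral)
qed

lemma fourier_coeff_curve_measure:
  "fourier_coeff (curve_measure (poly_curve d a) l) \<nu> =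
     integral {0..1} (\<lambda>t. cis (poly (curve_phase d a l \<nu>) t))"
  unfolding fourier_coeff_def
  by (subst integral_curve_measure)
    (auto intro: continuous_on_subset[OF continuous_poly_curve] continuous_on_torus_char
      simp: torus_char_poly_curve)

lemma l1_norm_pos: "\<nu> \<noteq> 0 \<Longrightarrow> 0 < l1_norm \<nu>"
  unfolding l1_norm_def by (force simp: vec_eq_iff intro: sum_pos2)

theorem theorem4:
  fixes d :: nat and a :: "'n::finite \<Rightarrow> nat \<Rightarrow> real"
  assumes "CARD('n) \<le> d"
    and "\<And>x :: real ^ 'n. x \<noteq> 0 \<Longrightarrow> \<exists>k\<in>{1..d}. transpose_mult a x k \<noteq> 0"
  shows "\<exists>C>0. \<forall>l>0.
    (SUP \<nu>\<in>UNIV - {0 :: int ^ 'n}.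
       ereal (l1_norm \<nu> powr (1 / real d) *
              cmod (fourier_coeff (curve_measure (poly_curve d a) l) \<nu>)))
    \<le> ereal (C / l powr (1 / real d))"
proof -
  have "0 < CARD('n)" by simp
  hence d: "1 \<le> d" using assms(1) by linarith
  obtain K where K: "K > 0" "\<And>(q::real poly) s k. \<lbrakk>degree q \<le> d; 0 < s; 1 \<le> k; 1 / s ^ d \<le> \<bar>coeff q k\<bar>\<rbrakk> \<Longrightarrow>
      norm (integral {0..1} (\<lambda>t. cis (poly q t))) \<le> K * s"
    using oscillatory_integral_cis_poly[OF d] by blast
  obtain c where c: "c > 0"
    "\<And>x :: real ^ 'n. \<exists>k\<in>{1..d}. c * (\<Sum>i\<in>UNIV. \<bar>x $ i\<bar>) \<le> \<bar>transpose_mult a x k\<bar>"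
    using transpose_mult_bounded_below[OF assms(2)] by blast
  define C where "C = K / (2 * pi * c) powr (1 / d)"
  have "l1_norm \<nu> powr (1 / d) * cmod (fourier_coeff (curve_measure (poly_curve d a) l) \<nu>)
      \<le> C / l powr (1 / d)" if l: "l > 0" and \<nu>: "\<nu> \<noteq> 0" for l and \<nu> :: "int ^ 'n"
  proof -
    define N where "N = l1_norm \<nu>"
    have N: "0 < N" unfolding N_def by (rule l1_norm_pos[OF \<nu>])
    \<comment> \<open>\<open>B\<close> is the guaranteed size of some phase coefficient, and
      \<open>s\<close> is chosen to make it exactly \<open>1 / s ^ d\<close>.\<close>
    define B where "B = 2 * pi * c * l * N"
    have B: "0 < B" using c(1) l N by (simp add: B_def)
    define s where "s = 1 / B powr (1 / d)"
    have s: "0 < s" using B by (simp add: s_def)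
    have sd: "1 / s ^ d = B" using B d by (simp add: s_def power_divide powr_power)
    obtain k where k: "k \<in> {1..d}" "c * N \<le> \<bar>transpose_mult a (\<chi> i. of_int (\<nu> $ i)) k\<bar>"
      using c(2)[of "\<chi> i. of_int (\<nu> $ i)"] by (auto simp: N_def l1_norm_def)
    have "B = 2 * pi * l * (c * N)" by (simp add: B_def)
    also have "\<dots> \<le> 2 * pi * l * \<bar>transpose_mult a (\<chi> i. of_int (\<nu> $ i)) k\<bar>"
      using k(2) l by (intro mult_left_mono) auto
    also have "\<dots> = \<bar>coeff (curve_phase d a l \<nu>) k\<bar>"
      using k(1) l by (simp add: coeff_curve_phase abs_mult)
    finally have "1 / s ^ d \<le> \<bar>coeff (curve_phase d a l \<nu>) k\<bar>" by (simp only: sd)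
    hence "cmod (fourier_coeff (curve_measure (poly_curve d a) l) \<nu>) \<le> K * s"
      unfolding fourier_coeff_curve_measure
      using k(1) by (intro K(2)[OF degree_curve_phase s]) auto
    hence "N powr (1 / d) * cmod (fourier_coeff (curve_measure (poly_curve d a) l) \<nu>)
        \<le> N powr (1 / d) * (K * s)"
      by (intro mult_left_mono) auto
    \<comment> \<open>The factor \<open>N powr (1 / d)\<close> in the denominator of
      \<open>s\<close> cancels the weight, leaving a bound independent of \<nu>; what remains
      besides \<open>l\<close> is \<open>C\<close>.\<close>
    also have "B powr (1 / d) = (2 * pi * c) powr (1 / d) * l powr (1 / d) * N powr (1 / d)"
      using c(1) l N unfolding B_def by (simp add: powr_mult)
    hence "N powr (1 / d) * (K * s) = C / l powr (1 / d)"
      using N by (simp add: s_def C_def)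
    finally show ?thesis by (simp add: N_def)
  qed
  note bound = this
  have "C > 0" using K(1) c(1) by (simp add: C_def)
  thus ?thesis
    \<comment> \<open>A supremum in \<open>ereal\<close> is a least upper bound with no boundedness
      condition to check, so the bound for each nonzero \<nu> suffices.\<close>
    by (intro exI[of _ C] conjI allI impI SUP_least) (simp_all add: bound)
qed

end
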